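(* Let $r\ge 2$ be a fixed integer and let $p=p(n)$ satisfy \[ \Omega\!\left(\frac{1}{n^{(r-1)/2}}\right) = p = O\!\left(\frac{\sqrt{\log n}}{n^{(r-1)/4}}\right). \] Then, a.a.s., \[ \Omega\!\left(\frac{np^{1/(r-1)}}{(\log n)^{1/(r-1)}}\right) = \ell_{\max} = O\!\left(np^{1/(r-1)}\right), \] where $\ell_{\max}$ is the maximal length of an ordered loose path in the random $r$-uniform hypergraph $H^{(r)}(n,p)$.
   Context: Let $r\ge 2$ be a fixed integer (constant). $H=H^{(r)}(n,p)$ is the random $r$-uniform hypergraph on the vertex set $[n]=\{1,\dots,n\}$ in which each $r$-element subset of $[n]$ is included as an edge independently with probability $p=p(n)\in[0,1]$. An ordered loose path of length $\ell$ in $H$ is an increasing sequence of vertices $v_1<v_2<\dots<v_{\ell(r-1)+1}$ in $[n]$ such that the $\ell$ sets $\{v_{(k-1)(r-1)+1},v_{(k-1)(r-1)+2},\dots,v_{k(r-1)+1}\}$, $k=1,\dots,\ell$, are all edges of $H$ (so every two consecutive edges intersect in a single vertex). $\ell_{\max}$ denotes the maximal length of an ordered loose path in $H$. All asymptotics are as $n\to\infty$; "a.a.s." means with probability tending to $1$ as $n\to\infty$. $\Omega(f(n))=p=O(g(n))$ means that there are constants $c,C>0$ with $c f(n)\le p\le C g(n)$ for all large $n$. "A.a.s. $\Omega(f(n))=\ell_{\max}=O(g(n))$" means that there are constants $c',C'>0$ (not depending on $n$) such that a.a.s. $c' f(n)\le\ell_{\max}\le C' g(n)$. *)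

theory Defs
  imports "HOL-Probability.Probability" "HOL-Library.Landau_Symbols"
begin

definition r_subsets :: "nat \<Rightarrow> nat \<Rightarrow> nat set set" where
  "r_subsets r n = {e. e \<subseteq> {1..n} \<and> card e = r}"

text \<open>The random hypergraph is the distribution of its edge set; the vertex set is always \<open>{1..n}\<close>.\<close>

definition random_hypergraph :: "nat \<Rightarrow> nat \<Rightarrow> real \<Rightarrow> nat set set pmf" where
  "random_hypergraph r n p =
     map_pmf (\<lambda>X. {e \<in> r_subsets r n. X e})
       (Pi_pmf (r_subsets r n) False (\<lambda>_. bernoulli_pmf p))"

definition ordered_loose_path ::
    "nat \<Rightarrow> nat \<Rightarrow> nat set set \<Rightarrow> nat \<Rightarrow> (nat \<Rightarrow> nat) \<Rightarrow> bool" where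
  "ordered_loose_path r n H l v \<longleftrightarrow>
     strict_mono_on {1..l * (r - 1) + 1} v \<and>
     v ` {1..l * (r - 1) + 1} \<subseteq> {1..n} \<and>
     (\<forall>k\<in>{1..l}. v ` {(k - 1) * (r - 1) + 1..k * (r - 1) + 1} \<in> H)"

text \<open>A single vertex is a path of length \<open>0\<close>, so for \<open>r \<ge> 2\<close> and \<open>n \<ge> 1\<close> the maximum is
  taken over a finite nonempty set.\<close>

definition l_max :: "nat \<Rightarrow> nat \<Rightarrow> nat set set \<Rightarrow> nat" where
  "l_max r n H = Max {l. \<exists>v. ordered_loose_path r n H l v}"

lemma ordered_loose_path_length_le:
  assumes "r \<ge> 2" "ordered_loose_path r n H l v"
  shows "l < n"
proof -
  have "inj_on v {1..l * (r - 1) + 1}"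
    using assms(2) strict_mono_on_imp_inj_on unfolding ordered_loose_path_def by blast
  then have "card {1..l * (r - 1) + 1} \<le> card {1..n}"
    using assms(2) card_inj_on_le[of v _ "{1..n}"] unfolding ordered_loose_path_def by blast
  then have "l * (r - 1) + 1 \<le> n" by simp
  moreover have "l * 1 \<le> l * (r - 1)"
    using assms(1) by (intro mult_le_mono) auto
  ultimately show ?thesis by linarith
qed

lemma finite_path_lengths:
  assumes "r \<ge> 2"
  shows "finite {l. \<exists>v. ordered_loose_path r n H l v}"
  by (rule finite_subset[of _ "{..<n}"]) (use assms ordered_loose_path_length_le in auto)

lemma path_lengths_nonempty:
  assumes "n \<ge> 1"
  shows "0 \<in> {l. \<exists>v. ordered_loose_path r n H l v}"
  using assms by (auto simp: ordered_loose_path_def strict_mono_on_def intro!: exI[of _ "\<lambda>_. 1"])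

end

theory Submission
  imports Defs "HOL-Real_Asymp.Real_Asymp"
begin

text \<open>
  Write \<open>s = r - 1\<close>. The upper bound is a first moment computation: an ordered path of length \<open>l\<close>
  is determined by its \<open>m = l s + 1\<close> vertices, so the expected number of such paths is at most
  \<open>(n choose m) p^l \<le> e n ((e n / m)^s p)^l\<close>, which is exponentially small in \<open>l\<close> once
  \<open>l > e^2 n p^(1/s)\<close>.

  For the lower bound the path is built greedily. With \<open>L\<close> of order \<open>(ln n / p)^(1/s)\<close>, the
  probability that a fixed vertex \<open>u \<le> n - L\<close> is not the minimum of any edge inside \<open>{u..u + L}\<close> is
  at most \<open>exp (- p (L choose s)) \<le> n^(-2)\<close>. Hence a.a.s. every such vertex has an edge of
  this kind, and the path can always be continued by advancing at most \<open>L\<close>.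
\<close>

subsection \<open>Ordered loose paths\<close>

lemma ordered_loose_path_prefix:
  assumes "ordered_loose_path r n H l v" "l' \<le> l"
  shows "ordered_loose_path r n H l' v"
proof -
  have "{1..l' * (r - 1) + 1} \<subseteq> {1..l * (r - 1) + 1}"
    using assms(2) by simp
  moreover have "{1..l'} \<subseteq> {1..l}"
    using assms(2) by simp
  ultimately show ?thesis
    using assms(1) unfolding ordered_loose_path_def
    by (meson monotone_on_subset image_mono order_trans subsetD)
qed

text \<open>Truncation makes the set of path lengths an initial segment of the naturals. An event
  about \<open>l_max\<close> thereby becomes the existence of a path of one exact length, which is
  what both the first moment bound and the greedy construction address.\<close>

lemma ex_ordered_loose_path_iff_le_l_max:
  assumes "r \<ge> 2" "n \<ge> 1"
  shows "(\<exists>v. ordered_loose_path r n H l v) \<longleftrightarrow> l \<le> l_max r n H"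
proof
  assume "\<exists>v. ordered_loose_path r n H l v"
  then show "l \<le> l_max r n H"
    unfolding l_max_def using finite_path_lengths[OF assms(1)] by (intro Max_ge) auto
next
  assume "l \<le> l_max r n H"
  moreover have "l_max r n H \<in> {l. \<exists>v. ordered_loose_path r n H l v}"
    unfolding l_max_def
    using Max_in[OF finite_path_lengths[OF assms(1)]] path_lengths_nonempty[OF assms(2)] by blast
  ultimately show "\<exists>v. ordered_loose_path r n H l v"
    using ordered_loose_path_prefix by blast
qed

text \<open>The induction on \<open>l\<close> carries the position of the last vertex along. As that
  vertex is at most \<open>l * L + 1\<close>, the window of length \<open>L\<close> above it stays
  inside \<open>{1..n}\<close> whenever \<open>Suc l * L + 1 \<le> n\<close>, so \<open>step\<close>
  applies once more.\<close>

lemma greedy_path: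
  assumes "r \<ge> 2"
    and step: "\<And>u. 1 \<le> u \<Longrightarrow> u + L \<le> n \<Longrightarrow> \<exists>W\<subseteq>{u<..u + L}. card W = r - 1 \<and> insert u W \<in> H"
    and "l * L + 1 \<le> n"
  shows "\<exists>v. ordered_loose_path r n H l v \<and> v (l * (r - 1) + 1) \<le> l * L + 1"
  using assms(3)
proof (induction l)
  case 0
  then have "ordered_loose_path r n H 0 (\<lambda>_. 1)"
    by (auto simp: ordered_loose_path_def strict_mono_on_def)
  then show ?case by auto
next
  case (Suc l)
  define s where "s = r - 1"
  define m where "m = l * s + 1"
  have s: "s \<ge> 1" using assms(1) by (simp add: s_def)
  from Suc obtain v where v: "ordered_loose_path r n H l v" and v_end: "v m \<le> l * L + 1"
    by (auto simp: m_def s_def)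
  have v_mono: "strict_mono_on {1..m} v" and v_range: "v ` {1..m} \<subseteq> {1..n}"
    and v_edges: "\<And>k. k \<in> {1..l} \<Longrightarrow> v ` {(k - 1) * s + 1..k * s + 1} \<in> H"
    using v by (auto simp: ordered_loose_path_def m_def s_def)
  have "m \<in> {1..m}" by (simp add: m_def)
  then have "v m \<in> {1..n}" using v_range by blast
  then obtain W where W: "W \<subseteq> {v m<..v m + L}" "card W = s" "insert (v m) W \<in> H"
    using step[of "v m"] v_end Suc.prems by (auto simp: s_def)
  define ws where "ws = sorted_list_of_set W"
  have "finite W" using W(1) finite_subset by blast
  then have ws: "set ws = W" "length ws = s" "sorted_wrt (<) ws"
    using W(2) by (auto simp: ws_def)
  have ws_in: "v m < ws ! j" "ws ! j \<le> v m + L" if "j < s" for j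
    using W(1) ws(1,2) that nth_mem[of j ws] by auto
  \<comment> \<open>The elements of \<open>W\<close> are appended in increasing order; subtracting
    \<open>m + 1\<close> turns positions, which start at 1, into list indices, which start at
    0.\<close>
  define v' where "v' = (\<lambda>i. if i \<le> m then v i else ws ! (i - m - 1))"
  have last: "Suc l * s + 1 = m + s" by (simp add: m_def)
  have v_le: "v i \<le> v m" if "i \<in> {1..m}" for i
    using that v_mono by (cases "i = m") (auto simp: strict_mono_on_def intro: less_imp_le)
  have "strict_mono_on {1..m + s} v'"
  proof (rule strict_mono_onI)
    fix i j assume ij: "i \<in> {1..m + s}" "j \<in> {1..m + s}" "i < j"
    consider "j \<le> m" | "i \<le> m" "m < j" | "m < i" by linarith
    then show "v' i < v' j"
    proof cases
      case 1
      then show ?thesis using ij v_mono by (auto simp: v'_def strict_mono_on_def)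
    next
      case 2
      then show ?thesis
        using ij v_le[of i] ws_in(1)[of "j - m - 1"] by (auto simp: v'_def intro: le_less_trans)
    next
      case 3
      then show ?thesis
        using ij ws by (auto simp: v'_def intro!: sorted_wrt_nth_less[of "(<)" ws])
    qed
  qed
  moreover have "v' ` {1..m + s} \<subseteq> {1..n}"
  proof
    fix x assume "x \<in> v' ` {1..m + s}"
    then obtain i where i: "i \<in> {1..m + s}" "x = v' i" by auto
    show "x \<in> {1..n}"
    proof (cases "i \<le> m")
      case True
      then have "v i \<in> {1..n}" using i(1) v_range by (auto simp: image_subset_iff)
      then show ?thesis using i(2) True by (simp add: v'_def)
    next
      case False
      then have "i - m - 1 < s" using i(1) by auto
      then show ?thesis
        using ws_in[of "i - m - 1"] v_end Suc.prems i(2) False by (auto simp: v'_def)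
    qed
  qed
  moreover have "v' ` {(k - 1) * s + 1..k * s + 1} \<in> H" if "k \<in> {1..Suc l}" for k
  proof (cases "k = Suc l")
    case True
    \<comment> \<open>The new block begins at position \<open>m\<close>, not \<open>m + 1\<close>:
      the old end vertex \<open>v m\<close> is the one vertex shared with the preceding
      edge.\<close>
    have "{m..m + s} = insert m {m + 1..m + s}" by auto
    moreover have "v' ` {m + 1..m + s} = (!) ws ` {..<s}"
    proof -
      have "{m + 1..m + s} = (\<lambda>j. j + m + 1) ` {..<s}"
      proof safe
        fix i assume "i \<in> {m + 1..m + s}"
        then show "i \<in> (\<lambda>j. j + m + 1) ` {..<s}" by (intro image_eqI[of _ _ "i - m - 1"]) auto
      qed auto
      then show ?thesis by (simp only: image_image) (simp add: v'_def)
    qed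
    moreover have "(!) ws ` {..<s} = W"
      using ws by (auto simp: set_conv_nth)
    ultimately have "v' ` {m..m + s} = insert (v' m) W"
      by (simp only: image_insert)
    then have "v' ` {m..m + s} = insert (v m) W"
      by (simp add: v'_def)
    then show ?thesis using W(3) True by (simp add: m_def add.commute)
  next
    case False
    then have k: "k \<in> {1..l}" using that by auto
    then have "k * s + 1 \<le> m" by (simp add: m_def)
    then have "v' ` {(k - 1) * s + 1..k * s + 1} = v ` {(k - 1) * s + 1..k * s + 1}"
      by (intro image_cong) (auto simp: v'_def)
    then show ?thesis using v_edges[OF k] by simp
  qed
  ultimately have "ordered_loose_path r n H (Suc l) v'"
    unfolding ordered_loose_path_def s_def[symmetric] last by blast
  moreover have "v' (Suc l * (r - 1) + 1) \<le> Suc l * L + 1"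
    unfolding s_def[symmetric] last
    using s ws_in(2)[of "s - 1"] v_end by (auto simp: v'_def)
  ultimately show ?case by blast
qed

subsection \<open>Edge probabilities\<close>

lemma finite_r_subsets: "finite (r_subsets r n)"
  by (rule finite_subset[of _ "Pow {1..n}"]) (auto simp: r_subsets_def)

text \<open>A condition on the coordinates in \<open>E\<close> alone is a product box whose other
  factors are the full space and contribute 1. Leaving \<open>b\<close> open covers both uses: all
  edges present and all edges absent.\<close>

lemma prob_Pi_pmf_restrict:
  assumes "finite A" "E \<subseteq> A"
  shows "measure_pmf.prob (Pi_pmf A d P) {X. \<forall>e\<in>E. X e = b} = (\<Prod>e\<in>E. pmf (P e) b)"
proof -
  have "{X. \<forall>e\<in>E. X e = b} = Pi A (\<lambda>e. if e \<in> E then {b} else UNIV)"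
    using assms(2) by (auto simp: Pi_def)
  then have "measure_pmf.prob (Pi_pmf A d P) {X. \<forall>e\<in>E. X e = b}
      = (\<Prod>e\<in>A. if e \<in> E then pmf (P e) b else 1)"
    using assms(1)
    by (auto simp: measure_Pi_pmf_Pi measure_pmf_single intro!: prod.cong)
  also have "\<dots> = (\<Prod>e\<in>E. pmf (P e) b)"
    using assms by (simp add: prod.If_cases Int_absorb1)
  finally show ?thesis .
qed

lemma prob_edges_subset:
  assumes "0 \<le> q" "q \<le> 1" "E \<subseteq> r_subsets r n"
  shows "measure_pmf.prob (random_hypergraph r n q) {H. E \<subseteq> H} = q ^ card E"
proof -
  have "(\<lambda>X. {e \<in> r_subsets r n. X e}) -` {H. E \<subseteq> H} = {X. \<forall>e\<in>E. X e = True}"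
    using assms(3) by auto
  then show ?thesis
    unfolding random_hypergraph_def measure_map_pmf
    using prob_Pi_pmf_restrict[OF finite_r_subsets assms(3), of False "\<lambda>_. bernoulli_pmf q" True] assms(1,2)
    by simp
qed

lemma prob_edges_disjoint:
  assumes "0 \<le> q" "q \<le> 1" "E \<subseteq> r_subsets r n"
  shows "measure_pmf.prob (random_hypergraph r n q) {H. E \<inter> H = {}} = (1 - q) ^ card E"
proof -
  have "(\<lambda>X. {e \<in> r_subsets r n. X e}) -` {H. E \<inter> H = {}} = {X. \<forall>e\<in>E. X e = False}"
    using assms(3) by auto
  then show ?thesis
    unfolding random_hypergraph_def measure_map_pmf
    using prob_Pi_pmf_restrict[OF finite_r_subsets assms(3), of False "\<lambda>_. bernoulli_pmf q" False] assms(1,2)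
    by simp
qed

text \<open>Sorting recovers an increasing path from its vertex set, so the union bound can run over
  vertex sets instead of maps \<open>v\<close>. Each set prescribes \<open>l\<close> distinct
  edges.\<close>

lemma prob_path_le:
  assumes "r \<ge> 2" "0 \<le> q" "q \<le> 1"
  shows "measure_pmf.prob (random_hypergraph r n q) {H. \<exists>v. ordered_loose_path r n H l v}
    \<le> real (n choose (l * (r - 1) + 1)) * q ^ l"
proof -
  define s where "s = r - 1"
  define m where "m = l * s + 1"
  have s: "s \<ge> 1" and r: "r = s + 1" using assms(1) by (auto simp: s_def)
  \<comment> \<open>\<open>enum S i\<close> is the \<open>i\<close>-th smallest element of
    \<open>S\<close>, counted from 1 to match the positions of a path. \<open>edges S\<close>
    collects the edges needed by the path that runs through \<open>S\<close> in increasing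
    order.\<close>
  define enum where "enum = (\<lambda>S i. sorted_list_of_set S ! (i - 1) :: nat)"
  define blk where "blk = (\<lambda>k. {(k - 1) * s + 1..k * s + 1})"
  define edges where "edges = (\<lambda>S. (\<lambda>k. enum S ` blk k) ` {1..l})"
  define V where "V = {S. S \<subseteq> {1..n} \<and> card S = m}"
  let ?M = "random_hypergraph r n q"
  have finV: "finite V"
    by (rule finite_subset[of _ "Pow {1..n}"]) (auto simp: V_def)
  have blk_sub: "blk k \<subseteq> {1..m}" if "k \<in> {1..l}" for k
    using that by (auto simp: blk_def m_def intro: order_trans)
  have card_blk: "card (blk k) = r" if "k \<in> {1..l}" for k
    using that by (cases k) (auto simp: blk_def r)
  have prob_V: "measure_pmf.prob ?M {H. edges S \<subseteq> H} = q ^ l" if "S \<in> V" for S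
  proof -
    have S: "finite S" "S \<subseteq> {1..n}" "length (sorted_list_of_set S) = m"
      using that by (auto simp: V_def intro: finite_subset)
    have inj: "inj_on (enum S) {1..m}"
      using S by (intro inj_onI) (auto simp: enum_def nth_eq_iff_index_eq)
    have range: "enum S ` {1..m} \<subseteq> S"
    proof -
      have "enum S i \<in> S" if "i \<in> {1..m}" for i
        using S that nth_mem[of "i - 1" "sorted_list_of_set S"] by (auto simp: enum_def)
      then show ?thesis by auto
    qed
    have "edges S \<subseteq> r_subsets r n"
    proof
      fix e assume "e \<in> edges S"
      then obtain k where k: "k \<in> {1..l}" "e = enum S ` blk k" by (auto simp: edges_def)
      have "card e = r"
        unfolding k(2) using card_image inj_on_subset[OF inj blk_sub[OF k(1)]] card_blk[OF k(1)]
        by metis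
      moreover have "e \<subseteq> {1..n}"
        unfolding k(2) using range S(2) blk_sub[OF k(1)] by fastforce
      ultimately show "e \<in> r_subsets r n" by (simp add: r_subsets_def)
    qed
    moreover have "card (edges S) = l"
    proof -
      \<comment> \<open>Since \<open>s \<ge> 1\<close>, different blocks have different end points,
        and the injective enumeration keeps their images apart.\<close>
      have "inj_on (\<lambda>k. enum S ` blk k) {1..l}"
      proof (rule inj_onI)
        fix j k assume jk: "j \<in> {1..l}" "k \<in> {1..l}" "enum S ` blk j = enum S ` blk k"
        then have "blk j = blk k"
          using inj_on_image_eq_iff[OF inj blk_sub blk_sub] by blast
        then show "j = k"
          using s by (auto simp: blk_def Icc_eq_Icc)
      qed
      then show ?thesis by (simp add: edges_def card_image)
    qed
    ultimately show ?thesis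
      using prob_edges_subset[OF assms(2,3)] by simp
  qed
  have "{H. \<exists>v. ordered_loose_path r n H l v} \<subseteq> (\<Union>S\<in>V. {H. edges S \<subseteq> H})"
  proof
    fix H assume "H \<in> {H. \<exists>v. ordered_loose_path r n H l v}"
    then obtain v where v: "strict_mono_on {1..m} v" "v ` {1..m} \<subseteq> {1..n}"
      "\<And>k. k \<in> {1..l} \<Longrightarrow> v ` blk k \<in> H"
      by (auto simp: ordered_loose_path_def m_def s_def blk_def)
    have inj: "inj_on v {1..m}" using v(1) strict_mono_on_imp_inj_on by blast
    \<comment> \<open>A strictly increasing list is the sorted list of its own set, so
      \<open>enum\<close> applied to the vertex set of the path returns \<open>v\<close>.\<close>
    have sorted: "sorted_list_of_set (v ` {1..m}) = map v [1..<Suc m]"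
    proof -
      have "sorted_wrt (<) (map v [1..<Suc m])"
        using v(1) by (auto simp: sorted_wrt_iff_nth_less strict_mono_on_def nth_append)
      moreover have "set (map v [1..<Suc m]) = v ` {1..m}"
        by (auto simp: atLeastLessThanSuc_atLeastAtMost simp del: upt_Suc)
      ultimately show ?thesis
        by (metis strict_sorted_iff distinct_card sorted_list_of_set.sorted_key_list_of_set_unique
            finite_imageI finite_atLeastAtMost)
    qed
    have enum: "enum (v ` {1..m}) i = v i" if "i \<in> {1..m}" for i
      using that unfolding enum_def sorted by (subst nth_map) (auto simp del: upt_Suc)
    have "enum (v ` {1..m}) ` blk k = v ` blk k" if "k \<in> {1..l}" for k
      using enum blk_sub[OF that] by (intro image_cong) auto
    then have "edges (v ` {1..m}) \<subseteq> H"
      using v(3) by (auto simp: edges_def)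
    moreover have "v ` {1..m} \<in> V"
      using v(2) card_image[OF inj] by (simp add: V_def)
    ultimately show "H \<in> (\<Union>S\<in>V. {H. edges S \<subseteq> H})" by blast
  qed
  then have "measure_pmf.prob ?M {H. \<exists>v. ordered_loose_path r n H l v}
      \<le> measure_pmf.prob ?M (\<Union>S\<in>V. {H. edges S \<subseteq> H})"
    by (intro measure_pmf.finite_measure_mono) auto
  also have "\<dots> \<le> (\<Sum>S\<in>V. measure_pmf.prob ?M {H. edges S \<subseteq> H})"
    using finV by (intro measure_pmf.finite_measure_subadditive_finite) auto
  also have "\<dots> = real (card V) * q ^ l"
    using prob_V by simp
  also have "card V = n choose m"
    unfolding V_def using n_subsets[of "{1..n}" m] by simp
  finally show ?thesis by (simp add: m_def s_def)
qed

text \<open>For fixed \<open>u\<close> there are \<open>L choose (r - 1)\<close> candidate edges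
  with minimum \<open>u\<close>, absent independently of each other, and
  \<open>1 - q \<le> exp (- q)\<close>. The factor \<open>n\<close> is the union bound over
  \<open>u\<close>.\<close>

lemma prob_no_step_le:
  assumes "r \<ge> 2" "0 \<le> q" "q \<le> 1"
  shows "measure_pmf.prob (random_hypergraph r n q)
      {H. \<exists>u. 1 \<le> u \<and> u + L \<le> n \<and> \<not> (\<exists>W\<subseteq>{u<..u + L}. card W = r - 1 \<and> insert u W \<in> H)}
    \<le> real n * exp (- (q * real (L choose (r - 1))))"
proof -
  let ?M = "random_hypergraph r n q"
  define U where "U = {u. 1 \<le> u \<and> u + L \<le> n}"
  define E where "E = (\<lambda>u. insert u ` {W. W \<subseteq> {u<..u + L} \<and> card W = r - 1})"
  have U: "U \<subseteq> {1..n}" by (auto simp: U_def)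
  then have finU: "finite U" by (rule finite_subset) auto
  have prob_E: "measure_pmf.prob ?M {H. E u \<inter> H = {}} \<le> exp (- (q * real (L choose (r - 1))))"
    if "u \<in> U" for u
  proof -
    have "E u \<subseteq> r_subsets r n"
    proof
      fix e assume "e \<in> E u"
      then obtain W where W: "e = insert u W" "W \<subseteq> {u<..u + L}" "card W = r - 1"
        by (auto simp: E_def)
      then have "finite W" "u \<notin> W" using finite_subset by auto
      then have "card e = r" using W assms(1) by simp
      moreover have "e \<subseteq> {1..n}" using W that by (auto simp: U_def)
      ultimately show "e \<in> r_subsets r n" by (simp add: r_subsets_def)
    qed
    moreover have "card (E u) = L choose (r - 1)"
    proof -
      have "inj_on (insert u) {W. W \<subseteq> {u<..u + L} \<and> card W = r - 1}"
      proof (rule inj_onI)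
        fix W W' assume "W \<in> {W. W \<subseteq> {u<..u + L} \<and> card W = r - 1}"
          "W' \<in> {W. W \<subseteq> {u<..u + L} \<and> card W = r - 1}" "insert u W = insert u W'"
        moreover from this have "u \<notin> W" "u \<notin> W'" by auto
        ultimately show "W = W'" by (metis insert_ident)
      qed
      then show ?thesis
        unfolding E_def using n_subsets[of "{u<..u + L}" "r - 1"] by (simp add: card_image)
    qed
    ultimately have "measure_pmf.prob ?M {H. E u \<inter> H = {}} = (1 - q) ^ (L choose (r - 1))"
      using prob_edges_disjoint[OF assms(2,3)] by simp
    also have "\<dots> \<le> exp (- q) ^ (L choose (r - 1))"
      using assms(3) exp_ge_add_one_self[of "- q"] by (intro power_mono) auto
    also have "\<dots> = exp (- (q * real (L choose (r - 1))))"
      by (simp flip: exp_of_nat_mult add: mult.commute)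
    finally show ?thesis .
  qed
  have "{H. \<exists>u. 1 \<le> u \<and> u + L \<le> n \<and> \<not> (\<exists>W\<subseteq>{u<..u + L}. card W = r - 1 \<and> insert u W \<in> H)}
      = (\<Union>u\<in>U. {H. E u \<inter> H = {}})"
    by (auto simp: U_def E_def)
  then have "measure_pmf.prob ?M {H. \<exists>u. 1 \<le> u \<and> u + L \<le> n \<and>
        \<not> (\<exists>W\<subseteq>{u<..u + L}. card W = r - 1 \<and> insert u W \<in> H)}
      \<le> (\<Sum>u\<in>U. measure_pmf.prob ?M {H. E u \<inter> H = {}})"
    using finU by (auto intro!: measure_pmf.finite_measure_subadditive_finite)
  also have "\<dots> \<le> real (card U) * exp (- (q * real (L choose (r - 1))))"
    using prob_E by (intro sum_bounded_above) auto
  also have "\<dots> \<le> real n * exp (- (q * real (L choose (r - 1))))"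
    using card_mono[OF _ U] by (intro mult_right_mono) auto
  finally show ?thesis .
qed

subsection \<open>Binomial estimates\<close>

text \<open>This is a single term of a series with nonnegative terms. At \<open>x = m\<close> it
  bounds \<open>m ^ m / fact m\<close> by \<open>exp m\<close>, which takes the place of Stirling's
  formula in the binomial estimate.\<close>

lemma power_div_fact_le_exp:
  fixes x :: real
  assumes "x \<ge> 0"
  shows "x ^ m / fact m \<le> exp x"
proof -
  have "(\<Sum>k\<in>{m}. x ^ k /\<^sub>R fact k) \<le> (\<Sum>k. x ^ k /\<^sub>R fact k)"
    using assms by (intro sum_le_suminf summable_exp_generic) auto
  then show ?thesis by (simp add: exp_def field_simps)
qed

lemma binomial_le_exp_power:
  assumes "m \<ge> 1"
  shows "real (n choose m) \<le> (exp 1 * real n / real m) ^ m"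
proof -
  have "real (n choose m) * fact m \<le> real n ^ m"
    using binomial_fact_pow[of n m] by (metis of_nat_fact of_nat_le_iff of_nat_mult of_nat_power)
  then have "real (n choose m) \<le> (real n / real m) ^ m * (real m ^ m / fact m)"
    using assms by (simp add: field_simps)
  also have "\<dots> \<le> (real n / real m) ^ m * exp (real m)"
    by (intro mult_left_mono power_div_fact_le_exp) auto
  also have "\<dots> = (exp 1 * real n / real m) ^ m"
    by (simp add: power_mult_distrib power_divide flip: exp_of_nat_mult)
  finally show ?thesis .
qed

lemma powr_one_div_power:
  fixes x :: real
  assumes "x > 0" "s \<ge> 1"
  shows "(x powr (1 / real s)) ^ s = x"
  using assms by (simp add: powr_powr flip: powr_realpow)

subsection \<open>Tail bounds\<close>

lemma prob_l_max_upper: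
  fixes q :: real
  assumes "r \<ge> 2" "n \<ge> 1" "0 < q" "q \<le> 1"
  defines "a \<equiv> real n * q powr (1 / (real r - 1))"
  shows "measure_pmf.prob (random_hypergraph r n q) {H. exp 2 * a < real (l_max r n H)}
    \<le> exp 1 * real n * exp (- (exp 2 * a))"
proof -
  define s where "s = r - 1"
  have s: "s \<ge> 1" and rs: "real r - 1 = real s" using assms(1) by (auto simp: s_def)
  define \<rho> where "\<rho> = q powr (1 / real s)"
  have \<rho>: "\<rho> > 0" "\<rho> ^ s = q"
    using powr_one_div_power[OF assms(3) s] assms(3) by (auto simp: \<rho>_def)
  have a: "a = real n * \<rho>" "a > 0" using assms(2) \<rho> by (auto simp: a_def rs \<rho>_def)
  \<comment> \<open>The least integer above \<open>exp 2 * a\<close>; as \<open>l_max\<close> is an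
    integer, exceeding \<open>exp 2 * a\<close> forces a path of length exactly
    \<open>l\<close>.\<close>
  define l where "l = nat \<lfloor>exp 2 * a\<rfloor> + 1"
  have l: "exp 2 * a < real l"
    using a(2) unfolding l_def by linarith
  define m where "m = l * s + 1"
  have "l \<le> l * s" using s by (cases s) auto
  then have "l \<le> m" unfolding m_def by linarith
  define y where "y = exp 1 * real n / real m"
  have y0: "y \<ge> 0" by (simp add: y_def)
  \<comment> \<open>With \<open>a = n * \<rho>\<close> and \<open>m \<ge> l\<close>, the constant
    \<open>exp 2\<close> absorbs the \<open>exp 1\<close> of the binomial estimate and still leaves
    \<open>y * \<rho> \<le> exp (- 1)\<close>. Taking \<open>s\<close>-th powers turns
    \<open>\<rho>\<close> into \<open>q\<close> and, as \<open>s \<ge> 1\<close>, keeps the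
    bound.\<close>
  have "y ^ s * q \<le> exp (- 1)"
  proof -
    have "exp 2 * a \<le> real m" using l \<open>l \<le> m\<close> by linarith
    then have "y \<le> exp 1 * real n / (exp 2 * a)"
      unfolding y_def using a(2) by (intro divide_left_mono mult_pos_pos) (auto simp: m_def simp del: of_nat_Suc)
    also have "\<dots> = exp (- 1) / \<rho>"
    proof -
      have "exp (2::real) = exp 1 * exp 1" by (simp flip: exp_add)
      then show ?thesis using assms(2) \<rho> by (simp add: a exp_minus field_simps)
    qed
    finally have "y * \<rho> \<le> exp (- 1)" using \<rho> by (simp add: field_simps)
    then have "(y * \<rho>) ^ s \<le> exp (- 1) ^ s" using y0 \<rho> by (intro power_mono) auto
    also have "\<dots> \<le> exp (- 1) ^ 1" using s by (intro power_decreasing) auto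
    finally show ?thesis using \<rho> by (simp add: power_mult_distrib)
  qed
  have "{H. exp 2 * a < real (l_max r n H)} \<subseteq> {H. \<exists>v. ordered_loose_path r n H l v}"
  proof
    fix H assume "H \<in> {H. exp 2 * a < real (l_max r n H)}"
    then have "\<lfloor>exp 2 * a\<rfloor> < int (l_max r n H)" by (simp add: floor_less_iff)
    moreover have "\<lfloor>exp 2 * a\<rfloor> \<ge> 0" using a(2) by simp
    ultimately have "l \<le> l_max r n H" unfolding l_def by presburger
    then show "H \<in> {H. \<exists>v. ordered_loose_path r n H l v}"
      using ex_ordered_loose_path_iff_le_l_max[OF assms(1,2)] by simp
  qed
  then have "measure_pmf.prob (random_hypergraph r n q) {H. exp 2 * a < real (l_max r n H)}
      \<le> measure_pmf.prob (random_hypergraph r n q) {H. \<exists>v. ordered_loose_path r n H l v}"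
    by (intro measure_pmf.finite_measure_mono) auto
  also have "\<dots> \<le> real (n choose m) * q ^ l"
    using prob_path_le[OF assms(1), of q n l] assms(3,4) by (simp add: m_def s_def)
  also have "\<dots> \<le> y ^ m * q ^ l"
    unfolding y_def using assms(3) by (intro mult_right_mono binomial_le_exp_power) (auto simp: m_def)
  \<comment> \<open>Each edge accounts for \<open>s\<close> vertices; the one left over in
    \<open>m = l * s + 1\<close> costs a single factor \<open>y\<close>, at most
    \<open>exp 1 * n\<close>.\<close>
  also have "\<dots> = y * (y ^ s * q) ^ l"
    by (simp add: m_def power_mult_distrib power_mult mult.commute[of l s])
  also have "\<dots> \<le> exp 1 * real n * exp (- 1) ^ l"
  proof (intro mult_mono power_mono)
    have "m \<ge> 1" by (simp add: m_def)
    then show "y \<le> exp 1 * real n"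
      unfolding y_def using divide_left_mono[of 1 "real m" "exp 1 * real n"] by simp
    show "y ^ s * q \<le> exp (- 1)" by fact
  qed (use y0 assms(3) in auto)
  also have "exp (- 1) ^ l = exp (- real l)"
    by (simp flip: exp_of_nat_mult)
  also have "exp 1 * real n * exp (- real l) \<le> exp 1 * real n * exp (- (exp 2 * a))"
    using l by (intro mult_left_mono) auto
  finally show ?thesis .
qed

text \<open>\<open>t\<close> is the window length, up to constants, at which a vertex expects about
  \<open>ln n\<close> edges starting at it. The size assumption ensures that enough windows fit for
  rounding to cost only a constant factor.\<close>

lemma prob_l_max_lower:
  fixes q :: real
  assumes "r \<ge> 2" "ln (real n) \<ge> 1" "0 < q" "q \<le> 1"
  defines "t \<equiv> (ln (real n) / q) powr (1 / (real r - 1))"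
  assumes n: "16 * (real r - 1) * t \<le> real n"
  shows "measure_pmf.prob (random_hypergraph r n q)
      {H. real (l_max r n H) < real n / (16 * (real r - 1) * t)} \<le> 1 / real n"
proof -
  define s where "s = r - 1"
  have s: "s \<ge> 1" and rs: "real r - 1 = real s" using assms(1) by (auto simp: s_def)
  have n1: "n \<ge> 1" using assms(2) by (cases "n = 0") auto
  have q: "ln (real n) / q \<ge> 1" using assms(2-4) by (simp add: field_simps)
  then have t: "t \<ge> 1" "t ^ s = ln (real n) / q"
    using powr_one_div_power[of "ln (real n) / q" s] s
    by (auto simp: t_def rs intro!: ge_one_powr_ge_zero)
  \<comment> \<open>The factor \<open>s\<close> cancels the denominator in
    \<open>L choose s \<ge> (L / s) ^ s\<close>. The factor 2 contributes
    \<open>2 ^ s \<ge> 2\<close>, so the exponent reaches \<open>2 * ln n\<close>, and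
    \<open>1 / n\<close> remains after the union bound over \<open>n\<close> vertices.\<close>
  define x where "x = 2 * real s * t"
  have x: "x \<ge> 2 * real s" using t(1) s by (simp add: x_def)
  define L where "L = nat \<lceil>x\<rceil>"
  \<comment> \<open>Rounding up at most doubles \<open>x\<close>, because \<open>t \<ge> 1\<close>
    makes \<open>x \<ge> 2\<close>.\<close>
  have L: "x \<le> real L" "real L \<le> 2 * x" "L \<ge> s" "L \<ge> 1"
    using x s unfolding L_def by linarith+
  have "2 * ln (real n) \<le> q * real (L choose s)"
  proof -
    have "2 * ln (real n) \<le> 2 ^ s * ln (real n)"
      using s assms(2) power_increasing[of 1 s "2::real"] by (intro mult_right_mono) auto
    also have "\<dots> = q * (2 * t) ^ s"
      using t(2) assms(3) by (simp add: power_mult_distrib)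
    also have "\<dots> \<le> q * (real L / real s) ^ s"
      using L(1) s t(1) assms(3)
      by (intro mult_left_mono power_mono) (auto simp: x_def field_simps)
    also have "\<dots> \<le> q * real (L choose s)"
      using binomial_ge_n_over_k_pow_k[OF L(3), where 'a = real] assms(3)
      by (intro mult_left_mono) auto
    finally show ?thesis .
  qed
  then have "exp (- (q * real (L choose s))) \<le> exp (- (2 * ln (real n)))"
    by simp
  also have "\<dots> = 1 / real n ^ 2"
    using n1 by (simp add: exp_minus exp_double field_simps)
  finally have exp_le: "real n * exp (- (q * real (L choose s))) \<le> 1 / real n"
    using n1 by (simp add: field_simps power2_eq_square)
  let ?bad = "{H. \<exists>u. 1 \<le> u \<and> u + L \<le> n \<and>
    \<not> (\<exists>W\<subseteq>{u<..u + L}. card W = r - 1 \<and> insert u W \<in> H)}"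
  have "{H. real (l_max r n H) < real n / (16 * (real r - 1) * t)} \<subseteq> ?bad"
  proof (rule ccontr)
    assume "\<not> ?thesis"
    then obtain H where H: "real (l_max r n H) < real n / (16 * (real r - 1) * t)"
      and "H \<notin> ?bad" by blast
    then have step: "\<And>u. 1 \<le> u \<Longrightarrow> u + L \<le> n \<Longrightarrow>
      \<exists>W\<subseteq>{u<..u + L}. card W = r - 1 \<and> insert u W \<in> H" by blast
    \<comment> \<open>The largest number of greedy steps with
      \<open>l * L + 1 \<le> n\<close>.\<close>
    define l where "l = (n - 1) div L"
    have "l * L \<le> n - 1" unfolding l_def by (simp add: div_times_less_eq_dividend)
    then have "l * L + 1 \<le> n" using n1 by linarith
    from greedy_path[OF assms(1) step this] have "l \<le> l_max r n H"
      using ex_ordered_loose_path_iff_le_l_max[OF assms(1) n1] by blast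
    moreover have "real n / (16 * (real r - 1) * t) \<le> real l"
    proof -
      \<comment> \<open>The size assumption says \<open>z \<ge> 4\<close>, and
        \<open>L \<le> 2 * x\<close> gives \<open>l \<ge> z - 1 \<ge> z / 4\<close>. The constant 16
        combines \<open>2 * x = 4 * s * t\<close> with this last factor 4.\<close>
      define z where "z = real n / (2 * x)"
      have "z \<ge> 4" using n x s t(1) by (simp add: z_def x_def rs field_simps)
      have "n - 1 < (l + 1) * L"
        using L(4) dividend_less_div_times[of L "n - 1"] by (simp add: l_def)
      then have "n \<le> (l + 1) * L" by linarith
      then have "real n \<le> (real l + 1) * real L"
        by (metis of_nat_1 of_nat_add of_nat_le_iff of_nat_mult)
      also have "\<dots> \<le> (real l + 1) * (2 * x)" using L(2) by (intro mult_left_mono) auto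
      finally have "z \<le> real l + 1" using x s by (simp add: z_def divide_le_eq)
      moreover have "real n / (16 * (real r - 1) * t) = z / 4"
        by (simp add: z_def x_def rs)
      ultimately show ?thesis using \<open>z \<ge> 4\<close> by linarith
    qed
    ultimately show False using H by linarith
  qed
  then have "measure_pmf.prob (random_hypergraph r n q)
      {H. real (l_max r n H) < real n / (16 * (real r - 1) * t)}
      \<le> measure_pmf.prob (random_hypergraph r n q) ?bad"
    by (intro measure_pmf.finite_measure_mono) auto
  also have "\<dots> \<le> real n * exp (- (q * real (L choose s)))"
    using prob_no_step_le[OF assms(1), of q n L] assms(3,4) by (simp add: s_def)
  finally show ?thesis using exp_le by linarith
qed

section \<open>Combining the tail bounds as \<open>n\<close> tends to infinity\<close>

theorem theorem1p5:
  fixes r :: nat and p :: "nat \<Rightarrow> real"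
  assumes "r \<ge> 2"
    and "\<And>n. 0 \<le> p n \<and> p n \<le> 1"
    and "p \<in> \<Omega>(\<lambda>n. 1 / real n powr ((real r - 1) / 2))"
    and "p \<in> O(\<lambda>n. sqrt (ln (real n)) / real n powr ((real r - 1) / 4))"
  shows "\<exists>c C. c > 0 \<and> C > 0 \<and>
    (\<lambda>n. measure_pmf.prob (random_hypergraph r n (p n))
       {H. c * (real n * p n powr (1 / (real r - 1)) / ln (real n) powr (1 / (real r - 1)))
             \<le> real (l_max r n H) \<and>
           real (l_max r n H) \<le> C * (real n * p n powr (1 / (real r - 1)))})
      \<longlonglongrightarrow> 1"
proof -
  define s where "s = real r - 1"
  have s: "s \<ge> 1" using assms(1) by (simp add: s_def)
  obtain c0 where c0: "c0 > 0"
    and p_ge: "\<forall>\<^sub>F n in sequentially. c0 * norm (1 / real n powr (s / 2)) \<le> norm (p n)"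
    using landau_omega.bigE[OF assms(3)] unfolding s_def by blast
  \<comment> \<open>From \<open>p n \<ge> c0 / n powr (s / 2)\<close> it follows that
    \<open>exp 2 * a \<ge> c1 * sqrt n\<close>, which makes the upper tail vanish despite its factor
    \<open>n\<close>.\<close>
  define c1 where "c1 = exp 2 * c0 powr (1 / s)"
  have c1: "c1 > 0" using c0 by (simp add: c1_def)
  define good where "good = (\<lambda>n.
    {H. 1 / (16 * s) * (real n * p n powr (1 / s) / ln (real n) powr (1 / s)) \<le> real (l_max r n H) \<and>
        real (l_max r n H) \<le> exp 2 * (real n * p n powr (1 / s))})"
  \<comment> \<open>The comparison with \<open>c0\<close> gives \<open>ln n / c0 \<ge> 1\<close>, so
    that raising it to the power \<open>1 / s\<close> does not increase it.\<close>
  have ln_large: "\<forall>\<^sub>F n in sequentially. ln (real n) \<ge> max 1 c0"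
    by real_asymp
  \<comment> \<open>The left side dominates \<open>16 * s * t\<close>, so this provides the size
    assumption of \<open>prob_l_max_lower\<close>.\<close>
  have t_small: "\<forall>\<^sub>F n in sequentially. 16 * s * (ln (real n) / c0 * sqrt (real n)) \<le> real n"
    using c0 s by real_asymp
  have lower: "\<forall>\<^sub>F n in sequentially.
    1 - (exp 1 * real n * exp (- (c1 * sqrt (real n))) + 1 / real n)
      \<le> measure_pmf.prob (random_hypergraph r n (p n)) (good n)"
    using p_ge ln_large t_small
  proof eventually_elim
    case (elim n)
    let ?M = "random_hypergraph r n (p n)"
    have n: "n \<ge> 1" and ln: "ln (real n) \<ge> 1" "ln (real n) \<ge> c0"
      using elim(2) by (cases "n = 0"; auto)+
    \<comment> \<open>The root of order \<open>s\<close> that turns \<open>p n\<close> into the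
      scale of path lengths turns \<open>w\<close> into \<open>sqrt n\<close>.\<close>
    define w where "w = real n powr (s / 2)"
    have w: "w > 0" "w powr (1 / s) = sqrt (real n)"
      using n s by (auto simp: w_def powr_powr powr_half_sqrt)
    have p_w: "c0 / w \<le> p n"
      using elim(1) assms(2)[of n] w by (simp add: w_def)
    then have p: "0 < p n" "p n \<le> 1"
      using c0 w assms(2)[of n] by (auto intro: less_le_trans[OF divide_pos_pos])
    define a where "a = real n * p n powr (1 / s)"
    define t where "t = (ln (real n) / p n) powr (1 / s)"
    have "c1 * sqrt (real n) \<le> exp 2 * a"
    proof -
      have "c0 powr (1 / s) * sqrt (real n) = real n * (c0 powr (1 / s) / sqrt (real n))"
        using n by (simp add: field_simps)
      also have "c0 powr (1 / s) / sqrt (real n) = (c0 / w) powr (1 / s)"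
        using c0 w by (simp add: powr_divide)
      also have "real n * (c0 / w) powr (1 / s) \<le> a"
        unfolding a_def using p_w c0 w s by (intro mult_left_mono powr_mono2) auto
      finally show ?thesis by (simp add: c1_def)
    qed
    then have "exp 1 * real n * exp (- (exp 2 * a)) \<le> exp 1 * real n * exp (- (c1 * sqrt (real n)))"
      by (intro mult_left_mono) auto
    then have above: "measure_pmf.prob ?M {H. exp 2 * a < real (l_max r n H)}
        \<le> exp 1 * real n * exp (- (c1 * sqrt (real n)))"
      using prob_l_max_upper[OF assms(1) n p] unfolding a_def s_def by linarith
    have "t \<le> ln (real n) / c0 * sqrt (real n)"
    proof -
      have "t \<le> (ln (real n) / (c0 / w)) powr (1 / s)"
        unfolding t_def using p_w c0 w s ln p by (intro powr_mono2 divide_left_mono) auto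
      also have "\<dots> = (ln (real n) / c0) powr (1 / s) * sqrt (real n)"
        using c0 w(1) ln by (simp add: powr_mult flip: w(2) times_divide_eq_left)
      also have "\<dots> \<le> (ln (real n) / c0) powr 1 * sqrt (real n)"
        using ln c0 s by (intro mult_right_mono powr_mono) auto
      also have "\<dots> = ln (real n) / c0 * sqrt (real n)"
        using ln c0 by simp
      finally show ?thesis .
    qed
    then have "16 * s * t \<le> 16 * s * (ln (real n) / c0 * sqrt (real n))"
      using s by (intro mult_left_mono) auto
    then have "16 * s * t \<le> real n" using elim(3) by linarith
    then have below: "measure_pmf.prob ?M {H. real (l_max r n H) < real n / (16 * s * t)} \<le> 1 / real n"
      using prob_l_max_lower[OF assms(1) ln(1) p] unfolding t_def s_def by blast
    \<comment> \<open>Dividing \<open>n\<close> by \<open>t\<close> yields both the factor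
      \<open>p n powr (1 / s)\<close> and the logarithmic denominator of the claim.\<close>
    have "1 / (16 * s) * (real n * p n powr (1 / s) / ln (real n) powr (1 / s))
        = real n / (16 * s * t)"
      using p ln by (simp add: t_def powr_divide)
    \<comment> \<open>Failure is exactly the union of the two tails, so the error terms add
      up.\<close>
    then have "- good n = {H. exp 2 * a < real (l_max r n H)} \<union>
        {H. real (l_max r n H) < real n / (16 * s * t)}"
      by (auto simp: good_def a_def)
    then have "measure_pmf.prob ?M (- good n) \<le>
        exp 1 * real n * exp (- (c1 * sqrt (real n))) + 1 / real n"
      using above below
        measure_subadditive[of "{H. exp 2 * a < real (l_max r n H)}" ?M
          "{H. real (l_max r n H) < real n / (16 * s * t)}"]
      by (simp add: measure_pmf.emeasure_finite)
    then show ?case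
      using measure_pmf.prob_compl[of "good n" ?M] by (simp add: Compl_eq_Diff_UNIV)
  qed
  have "(\<lambda>n. measure_pmf.prob (random_hypergraph r n (p n)) (good n)) \<longlonglongrightarrow> 1"
  proof (rule tendsto_sandwich[OF lower _ _ tendsto_const])
    show "(\<lambda>n. 1 - (exp 1 * real n * exp (- (c1 * sqrt (real n))) + 1 / real n)) \<longlonglongrightarrow> 1"
      using c1 by real_asymp
  qed auto
  then show ?thesis
    using s unfolding good_def s_def by (intro exI[of _ "1 / (16 * (real r - 1))"] exI[of _ "exp 2"]) auto
qed

end
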